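(* As an identity of formal power series in $q$ (equivalently, of analytic functions for $|q|<1$), \[ \sum_{m,n\geq 0} \frac{(-1)^n q^{\frac{3n(3n+1)}{2} + m^2+ 3mn}}{(q;q)_m(q^3;q^3)_n} = \frac{1}{(q;q^3)_\infty}. \]
   Context: $(A;q)_n=\prod_{j=0}^{n-1}(1-Aq^j)$ and $(A;q)_\infty=\prod_{j\ge 0}(1-Aq^j)$. *)

theory Defs
  imports "HOL-Analysis.Analysis" "HOL-Computational_Algebra.Formal_Power_Series"
begin

(* Both symbols are stated over an abstract topological ring so that they apply to a complex
   number q as well as to the indeterminate fps_X. The topology of 'a fps is the library's
   X-adic metric: convergence means that every coefficient is eventually constant. *)

definition qpoch :: "'a::comm_ring_1 \<Rightarrow> 'a \<Rightarrow> nat \<Rightarrow> 'a" where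
  "qpoch A q n = (\<Prod>j<n. 1 - A * q ^ j)"

definition qpoch_inf :: "'a::{comm_ring_1, t2_space} \<Rightarrow> 'a \<Rightarrow> 'a" where
  "qpoch_inf A q = (\<Prod>j. 1 - A * q ^ j)"

end

theory Submission
  imports Defs
begin

text \<open>
  Put \<open>N = m + 3n\<close>. The exponent is \<open>binom(N+1, 2) + binom(m, 2)\<close>, so the sum is
  \<open>\<Sum>\<^sub>N q^binom(N+1, 2) c\<^sub>N\<close>, where by Euler's identities \<open>c\<^sub>N\<close> is the coefficient of \<open>z^N\<close> in
  \<open>(-z; q)\<^sub>\<infinity> / (-z\<^sup>3; q\<^sup>3)\<^sub>\<infinity>\<close>. With a primitive cube root of unity \<open>w\<close> this quotient is
  \<open>1 / ((-wz; q)\<^sub>\<infinity> (-w\<^sup>2z; q)\<^sub>\<infinity>)\<close>, which turns the sum into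
  \<open>\<Sum>\<^sub>i\<^sub>,\<^sub>j q^binom(i+j+1, 2) (-w)^i (-w\<^sup>2)^j / ((q; q)\<^sub>i (q; q)\<^sub>j)\<close>. Expanding \<open>q^(ij)\<close> decouples \<open>i\<close> from \<open>j\<close>
  at the cost of a third summation index \<open>n\<close>; Euler's identity in \<open>i\<close> and in \<open>j\<close> then gives
  \<open>(wq; q)\<^sub>\<infinity> (w\<^sup>2q; q)\<^sub>\<infinity> \<Sum>\<^sub>n (-1)^n q^(3 binom(n, 2) + 2n) / (q\<^sup>3; q\<^sup>3)\<^sub>n
    = (wq; q)\<^sub>\<infinity> (w\<^sup>2q; q)\<^sub>\<infinity> (q\<^sup>2; q\<^sup>3)\<^sub>\<infinity>\<close>,
  because \<open>(q; q)\<^sub>n (wq; q)\<^sub>n (w\<^sup>2q; q)\<^sub>n = (q\<^sup>3; q\<^sup>3)\<^sub>n\<close>. The same relation for \<open>n \<rightarrow> \<infinity>\<close> shows that this is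
  \<open>1 / (q; q\<^sup>3)\<^sub>\<infinity>\<close>.

  The complex numbers and the formal power series with their \<open>X\<close>-adic metric are both complete for
  a multiplicative absolute value, and the argument uses nothing else, so it is carried out once
  for all such rings.
\<close>

section \<open>Complete domains with a multiplicative absolute value\<close>

text \<open>Formal power series do not form a field, so division is only that of
  \<open>idom_divide\<close>: it undoes multiplication, and inverses have to be constructed. The two
  axioms make \<open>dist\<close> the metric of a multiplicative absolute value.\<close>

class valued_idom = complete_space + idom_divide +
  assumes dist_add_right: "dist (x + z) (y + z) = dist x y"
    and dist_mult_0: "dist (x * y) 0 = dist x 0 * dist y 0"

definition absv :: "'a::valued_idom \<Rightarrow> real" where
  "absv x = dist x 0"

lemma dist_absv: "dist x y = absv (x - y)" for x y :: "'a::valued_idom"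
  using dist_add_right[of "x - y" y 0] by (simp add: absv_def)

lemma absv_nonneg [simp]: "absv x \<ge> 0"
  by (simp add: absv_def)

lemma absv_eq_0_iff [simp]: "absv x = 0 \<longleftrightarrow> x = 0"
  by (simp add: absv_def)

lemma absv_0 [simp]: "absv 0 = 0"
  by simp

lemma absv_mult: "absv (x * y) = absv x * absv y"
  by (simp add: absv_def dist_mult_0)

lemma absv_1 [simp]: "absv 1 = 1"
  using absv_mult[of 1 1] absv_eq_0_iff[of 1] by (metis mult_cancel_right1 mult_1 zero_neq_one)

lemma absv_minus [simp]: "absv (- x) = absv x"
  using dist_absv[of 0 x] by (simp add: absv_def dist_commute)

lemma absv_power: "absv (x ^ n) = absv x ^ n"
  by (induction n) (simp_all add: absv_mult)

lemma absv_triangle: "absv (x + y) \<le> absv x + absv y"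
  using dist_triangle[of "x + y" 0 y] by (simp add: dist_absv)

lemma absv_one_minus_ge: "absv (1 - x) \<ge> 1 - absv x"
  using absv_triangle[of "1 - x" x] by simp

lemma absv_sum_le: "absv (sum f A) \<le> (\<Sum>x\<in>A. absv (f x))"
proof (induction A rule: infinite_finite_induct)
  case (insert x A)
  then show ?case
    using absv_triangle[of "f x" "sum f A"] by simp
qed simp_all

section \<open>Continuity of the ring operations\<close>

instance valued_idom < topological_comm_monoid_add
proof
  fix a b :: 'a
  show "((\<lambda>x. fst x + snd x) \<longlongrightarrow> a + b) (nhds a \<times>\<^sub>F nhds b)"
  proof (rule tendstoI)
    fix e :: real assume e: "e > 0"
    have "\<forall>\<^sub>F x in nhds a. dist x a < e / 2" "\<forall>\<^sub>F x in nhds b. dist x b < e / 2"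
      using e by (auto simp: eventually_nhds_metric intro!: exI[of _ "e / 2"])
    then have "\<forall>\<^sub>F x in nhds a \<times>\<^sub>F nhds b. dist (fst x) a < e / 2 \<and> dist (snd x) b < e / 2"
      by (rule eventually_prodI)
    then show "\<forall>\<^sub>F x in nhds a \<times>\<^sub>F nhds b. dist (fst x + snd x) (a + b) < e"
    proof eventually_elim
      case (elim x)
      then show ?case
        using absv_triangle[of "fst x - a" "snd x - b"] by (simp add: dist_absv algebra_simps)
    qed
  qed
qed

instance valued_idom < topological_semigroup_mult
proof
  fix a b :: 'a
  have lim: "((\<lambda>z. absv (fst z - a)) \<longlongrightarrow> 0) (nhds a \<times>\<^sub>F nhds b)"
            "((\<lambda>z. absv (snd z - b)) \<longlongrightarrow> 0) (nhds a \<times>\<^sub>F nhds b)"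
    unfolding dist_absv[symmetric]
    by (rule iffD1[OF tendsto_dist_iff filterlim_fst] iffD1[OF tendsto_dist_iff filterlim_snd])+
  have lim0: "((\<lambda>z. absv (fst z - a) * absv (snd z - b) + absv (fst z - a) * absv b
      + absv a * absv (snd z - b)) \<longlongrightarrow> 0) (nhds a \<times>\<^sub>F nhds b)"
    by (rule tendsto_eq_intros lim refl | simp)+
  have bound: "dist (fst z * snd z) (a * b) \<le> absv (fst z - a) * absv (snd z - b)
      + absv (fst z - a) * absv b + absv a * absv (snd z - b)" for z :: "'a \<times> 'a"
  proof -
    have "fst z * snd z - a * b = (fst z - a) * (snd z - b) + (fst z - a) * b + a * (snd z - b)"
      by (simp add: algebra_simps)
    then have "dist (fst z * snd z) (a * b)
        = absv ((fst z - a) * (snd z - b) + (fst z - a) * b + a * (snd z - b))"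
      by (simp only: dist_absv)
    also have "\<dots> \<le> absv ((fst z - a) * (snd z - b)) + absv ((fst z - a) * b) + absv (a * (snd z - b))"
      by (intro order_trans[OF absv_triangle] add_right_mono absv_triangle)
    finally show ?thesis
      by (simp add: absv_mult)
  qed
  have "((\<lambda>z. dist (fst z * snd z) (a * b)) \<longlongrightarrow> 0) (nhds a \<times>\<^sub>F nhds b)"
    by (rule tendsto_sandwich[OF _ _ tendsto_const lim0]; intro always_eventually allI bound zero_le_dist)
  then show "((\<lambda>z. fst z * snd z) \<longlongrightarrow> a * b) (nhds a \<times>\<^sub>F nhds b)"
    by (rule iffD2[OF tendsto_dist_iff])
qed

instance complex :: valued_idom
  by standard (simp_all add: dist_norm norm_mult)

text \<open>Two distinct series are at distance 2 to the power minus the subdegree of their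
  difference; this is multiplicative because subdegrees over a field add up in products.\<close>

instance fps :: (field) valued_idom
proof
  fix x y z :: "'a fps"
  show "dist (x + z) (y + z) = dist x y"
    by (simp add: dist_fps_def)
  show "dist (x * y) 0 = dist x 0 * dist y 0"
    by (simp add: dist_fps_def power_add)
qed

lemma absv_complex: "absv z = norm z" for z :: complex
  by (simp add: absv_def)

lemma absv_fps_X: "absv (fps_X :: 'a::field fps) = 1 / 2"
  by (simp add: absv_def dist_fps_def)

section \<open>Unconditional summation\<close>

text \<open>Absolute convergence makes the finite partial sums a Cauchy filter, and completeness
  supplies the limit.\<close>

lemma summable_on_if_absv_summable_on:
  fixes f :: "'b \<Rightarrow> 'a::valued_idom"
  assumes "(\<lambda>x. absv (f x)) summable_on A"
  shows "f summable_on A"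
proof -
  define g where "g = (\<lambda>x. absv (f x))"
  from assms obtain L where lim: "(sum g \<longlongrightarrow> L) (finite_subsets_at_top A)"
    unfolding summable_on_def has_sum_def g_def by blast
  have "cauchy_filter (filtermap (sum f) (finite_subsets_at_top A))"
    unfolding cauchy_filter_metric_filtermap
  proof (intro allI impI)
    fix e :: real assume e: "e > 0"
    have "\<forall>\<^sub>F F in finite_subsets_at_top A. dist (sum g F) L < e / 4"
      using lim e tendstoD[of "sum g" L "finite_subsets_at_top A" "e / 4"] by simp
    \<comment> \<open>The bound \<open>e / 4\<close> is doubled twice: comparing \<open>F\<close>
      with \<open>F0\<close> passes through \<open>L\<close>, and comparing \<open>F\<close> with
      \<open>F'\<close> passes through \<open>F0\<close>.\<close>
    then obtain F0 where F0: "finite F0" "F0 \<subseteq> A"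
      and near: "\<And>F. finite F \<Longrightarrow> F0 \<subseteq> F \<Longrightarrow> F \<subseteq> A \<Longrightarrow> dist (sum g F) L < e / 4"
      unfolding eventually_finite_subsets_at_top by auto
    have close: "dist (sum f F) (sum f F0) < e / 2" if F: "finite F" "F0 \<subseteq> F" "F \<subseteq> A" for F
    proof -
      have "dist (sum f F) (sum f F0) = absv (sum f (F - F0))"
        using F by (simp add: dist_absv sum_diff)
      also have "\<dots> \<le> sum g (F - F0)"
        unfolding g_def by (rule absv_sum_le)
      also have "\<dots> = sum g F - sum g F0"
        using F F0 by (simp add: sum_diff)
      also have "\<dots> < e / 2"
        using near[OF F] near[OF F0(1) order_refl F0(2)] unfolding dist_real_def by linarith
      finally show ?thesis .
    qed
    show "\<exists>P. eventually P (finite_subsets_at_top A) \<and>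
      (\<forall>F F'. P F \<and> P F' \<longrightarrow> dist (sum f F) (sum f F') < e)"
    proof (intro exI conjI allI impI)
      show "\<forall>\<^sub>F F in finite_subsets_at_top A. finite F \<and> F0 \<subseteq> F \<and> F \<subseteq> A"
        using F0 unfolding eventually_finite_subsets_at_top by blast
      fix F F' assume "(finite F \<and> F0 \<subseteq> F \<and> F \<subseteq> A) \<and> finite F' \<and> F0 \<subseteq> F' \<and> F' \<subseteq> A"
      then show "dist (sum f F) (sum f F') < e"
        using close[of F] close[of F'] dist_triangle2[of "sum f F" "sum f F'" "sum f F0"] by simp
    qed
  qed
  moreover have "filtermap (sum f) (finite_subsets_at_top A) \<noteq> bot"
    by (simp add: filtermap_bot_iff)
  ultimately obtain S where "filtermap (sum f) (finite_subsets_at_top A) \<le> nhds S"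
    using complete_UNIV[where ?'a = 'a] unfolding complete_uniform by auto
  then show ?thesis
    unfolding summable_on_def has_sum_def filterlim_def by blast
qed

lemma summable_on_if_absv_le:
  fixes f :: "'b \<Rightarrow> 'a::valued_idom"
  assumes "g summable_on A" and "\<And>x. x \<in> A \<Longrightarrow> absv (f x) \<le> g x"
  shows "f summable_on A"
  by (rule summable_on_if_absv_summable_on, rule summable_on_comparison_test[OF assms(1)])
     (use assms(2) in auto)

lemma absv_has_sum_le:
  fixes f :: "'b \<Rightarrow> 'a::valued_idom"
  assumes f: "(f has_sum S) A" and g: "(g has_sum s) A" and le: "\<And>x. x \<in> A \<Longrightarrow> absv (f x) \<le> g x"
  shows "absv S \<le> s"
proof -
  have "((\<lambda>F. absv (sum f F)) \<longlongrightarrow> absv S) (finite_subsets_at_top A)"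
    using f unfolding has_sum_def absv_def by (intro tendsto_intros)
  moreover have "(sum g \<longlongrightarrow> s) (finite_subsets_at_top A)"
    using g unfolding has_sum_def .
  moreover have "\<forall>\<^sub>F F in finite_subsets_at_top A. absv (sum f F) \<le> sum g F"
    using le by (intro eventually_finite_subsets_at_top_weakI order_trans[OF absv_sum_le] sum_mono) auto
  ultimately show ?thesis
    using tendsto_le[OF finite_subsets_at_top_neq_bot] by blast
qed

lemma has_sum_Suc:
  fixes f :: "nat \<Rightarrow> 'a::valued_idom"
  assumes "((\<lambda>n. f (Suc n)) has_sum S) UNIV"
  shows "(f has_sum (f 0 + S)) UNIV"
proof -
  have "(f has_sum S) (range Suc)"
    using assms by (subst has_sum_reindex) (auto simp: o_def)
  then have "(f has_sum (f 0 + S)) (insert 0 (range Suc))"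
    by (intro has_sum_insert) auto
  also have "insert 0 (range Suc) = UNIV"
    by (rule UNIV_nat_eq[symmetric])
  finally show ?thesis .
qed

text \<open>The inverse is the geometric series: splitting off its first term gives
  \<open>S = 1 + x * S\<close>.\<close>

lemma one_minus_invertible:
  fixes x :: "'a::valued_idom"
  assumes "absv x < 1"
  obtains y where "(1 - x) * y = 1"
proof -
  have "(\<lambda>n. absv x ^ n) summable_on UNIV"
    using assms by (simp add: summable_on_UNIV_nonneg_real_iff summable_geometric)
  then have "(\<lambda>n. x ^ n) summable_on UNIV"
    by (rule summable_on_if_absv_le) (simp add: absv_power)
  then obtain S where S: "((\<lambda>n. x ^ n) has_sum S) UNIV"
    unfolding summable_on_def by blast
  have "((\<lambda>n. x ^ n) has_sum (x ^ 0 + x * S)) UNIV"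
    by (rule has_sum_Suc) (use has_sum_cmult_right[OF S, of x] in simp)
  then have eq: "S = x ^ 0 + x * S"
    by (rule has_sum_unique[OF S])
  have "(1 - x) * S = S - x * S"
    by (simp add: algebra_simps)
  also have "\<dots> = 1"
    using eq by (metis add_diff_cancel_right' power_0)
  finally show ?thesis
    by (rule that)
qed

section \<open>Euler's identity\<close>

lemma qpoch_0 [simp]: "qpoch A q 0 = 1"
  by (simp add: qpoch_def)

lemma qpoch_Suc: "qpoch A q (Suc n) = qpoch A q n * (1 - A * q ^ n)"
  by (simp add: qpoch_def)

text \<open>For \<open>absv q < 1\<close> this is a true inverse, by \<open>qpoch_qinv\<close>; the
  series are written with it because products rearrange freely, unlike quotients under
  \<open>div\<close>.\<close>

definition qinv :: "'a::valued_idom \<Rightarrow> nat \<Rightarrow> 'a" where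
  "qinv q n = 1 div qpoch q q n"

lemma absv_mult_power_less_1:
  assumes "absv x < 1" "absv q < 1"
  shows "absv (x * q ^ n) < 1"
proof -
  have "absv q ^ n \<le> 1"
    using assms by (simp add: power_le_one)
  then show ?thesis
    using assms mult_left_le[of "absv q ^ n" "absv x"] by (simp add: absv_mult absv_power)
qed

lemma qpoch_nonzero:
  assumes "absv x < 1" "absv q < 1"
  shows "qpoch x q n \<noteq> 0"
proof -
  have "1 - x * q ^ j \<noteq> 0" for j
    using absv_one_minus_ge[of "x * q ^ j"] absv_mult_power_less_1[OF assms, of j] by force
  then show ?thesis
    unfolding qpoch_def by simp
qed

text \<open>Every factor is invertible by the geometric series, so induction gives an inverse;
  cancellation forces \<open>div\<close> to return it.\<close>

lemma qpoch_qinv: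
  assumes "absv q < 1"
  shows "qpoch q q n * qinv q n = 1"
proof -
  have "\<exists>r. qpoch q q n * r = 1"
  proof (induction n)
    case (Suc n)
    then obtain r where r: "qpoch q q n * r = 1"
      by blast
    obtain y where y: "(1 - q * q ^ n) * y = 1"
      using one_minus_invertible absv_mult_power_less_1[OF assms assms] by metis
    have "qpoch q q (Suc n) * (r * y) = (qpoch q q n * r) * ((1 - q * q ^ n) * y)"
      by (simp add: qpoch_Suc mult_ac)
    then show ?case
      using r y by auto
  qed simp
  then obtain r where r: "r * qpoch q q n = 1"
    by (auto simp: mult.commute)
  then have "qinv q n = r"
    using nonzero_mult_div_cancel_right[OF qpoch_nonzero[OF assms assms], of r n]
    by (simp add: qinv_def)
  then show ?thesis
    using r by (simp add: mult.commute)
qed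

lemma qinv_0 [simp]: "qinv q 0 = 1"
  using nonzero_mult_div_cancel_right[of 1 1] by (simp add: qinv_def)

lemma qinv_Suc:
  assumes "absv q < 1"
  shows "(1 - q ^ Suc n) * qinv q (Suc n) = qinv q n"
proof -
  have "qpoch q q n * ((1 - q ^ Suc n) * qinv q (Suc n)) = qpoch q q n * qinv q n"
    using qpoch_qinv[OF assms, of "Suc n"] qpoch_qinv[OF assms, of n]
    by (simp add: qpoch_Suc mult_ac)
  then show ?thesis
    using qpoch_nonzero[OF assms assms] by simp
qed

text \<open>Each factor of the denominator has absolute value at least \<open>1 - absv q\<close>.
  This crude bound suffices, since the estimates pair it with a power of \<open>q\<close> of
  quadratic exponent.\<close>

lemma absv_qinv_le:
  assumes "absv q < 1"
  shows "absv (qinv q n) \<le> (1 / (1 - absv q)) ^ n"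
proof (induction n)
  case (Suc n)
  have "absv q * absv q ^ n \<le> absv q * 1"
    using assms by (intro mult_left_mono power_le_one) auto
  then have ge: "1 - absv q \<le> absv (1 - q ^ Suc n)"
    using absv_one_minus_ge[of "q ^ Suc n"] by (simp add: absv_power absv_mult)
  have "(1 - absv q) * absv (qinv q (Suc n)) \<le> absv (1 - q ^ Suc n) * absv (qinv q (Suc n))"
    using ge by (intro mult_right_mono) auto
  also have "\<dots> = absv (qinv q n)"
    using qinv_Suc[OF assms, of n] by (simp flip: absv_mult)
  also have "\<dots> \<le> (1 / (1 - absv q)) ^ n"
    by (rule Suc.IH)
  finally show ?case
    using assms by (simp add: field_simps)
qed simp

section \<open>Quadratic exponents and real majorants\<close>

lemma choose_two_Suc: "Suc n choose 2 = n + (n choose 2)"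
  by (simp add: numeral_2_eq_2)

lemma choose_two_add: "(m + n) choose 2 = (m choose 2) + (n choose 2) + m * n"
  by (induction n) (simp_all add: choose_two_Suc)

text \<open>Consecutive terms have ratio \<open>t ^ n * K\<close>, which tends to 0.\<close>

lemma summable_on_power_choose_two:
  fixes t K :: real
  assumes "0 \<le> t" "t < 1" "0 \<le> K"
  shows "(\<lambda>n. t ^ (n choose 2) * K ^ n) summable_on UNIV"
proof -
  have "(\<lambda>n. t ^ n * K) \<longlonglongrightarrow> 0"
    using assms by (intro tendsto_mult_left_zero LIMSEQ_power_zero) auto
  then have "\<forall>\<^sub>F n in sequentially. t ^ n * K < 1 / 2"
    by (rule order_tendstoD) simp
  then obtain N where N: "\<And>n. n \<ge> N \<Longrightarrow> t ^ n * K < 1 / 2"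
    unfolding eventually_sequentially by blast
  have "summable (\<lambda>n. t ^ (n choose 2) * K ^ n)"
  proof (rule summable_ratio_test)
    fix n assume "n \<ge> N"
    then have "(t ^ n * K) * (t ^ (n choose 2) * K ^ n) \<le> 1 / 2 * (t ^ (n choose 2) * K ^ n)"
      using N[of n] assms by (intro mult_right_mono) auto
    then show "norm (t ^ (Suc n choose 2) * K ^ Suc n) \<le> 1 / 2 * norm (t ^ (n choose 2) * K ^ n)"
      using assms by (simp add: choose_two_Suc power_add mult_ac)
  qed simp
  then show ?thesis
    using assms by (simp add: summable_on_UNIV_nonneg_real_iff)
qed

lemma summable_on_mult_Times:
  fixes f :: "'a \<Rightarrow> real" and g :: "'b \<Rightarrow> real"
  assumes "f summable_on A" "g summable_on B"
    and "\<And>x. x \<in> A \<Longrightarrow> f x \<ge> 0" "\<And>y. y \<in> B \<Longrightarrow> g y \<ge> 0"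
  shows "(\<lambda>(x, y). f x * g y) summable_on A \<times> B"
proof (rule summable_on_SigmaI)
  show "((\<lambda>y. (\<lambda>(x, y). f x * g y) (x, y)) has_sum f x * infsum g B) B" for x
    using has_sum_cmult_right[OF has_sum_infsum[OF assms(2)]] by simp
  show "(\<lambda>x. f x * infsum g B) summable_on A"
    using assms(1) by (rule summable_on_cmult_left)
qed (use assms in auto)

text \<open>Euler's series for the infinite product \<open>(x; q)_infinity\<close>; for
  \<open>absv q < 1\<close> it converges at every \<open>x\<close>.\<close>

definition euler_sum :: "'a::valued_idom \<Rightarrow> 'a \<Rightarrow> 'a" where
  "euler_sum q x = (\<Sum>\<^sub>\<infinity>n. q ^ (n choose 2) * (- x) ^ n * qinv q n)"

lemma absv_euler_term_le:
  assumes "absv q < 1"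
  shows "absv (q ^ (n choose 2) * x ^ n * qinv q n)
    \<le> absv q ^ (n choose 2) * (absv x * (1 / (1 - absv q))) ^ n"
  unfolding absv_mult absv_power power_mult_distrib mult.assoc[symmetric]
  by (intro mult_left_mono absv_qinv_le assms) simp

lemma has_sum_euler_sum:
  assumes "absv q < 1"
  shows "((\<lambda>n. q ^ (n choose 2) * (- x) ^ n * qinv q n) has_sum euler_sum q x) UNIV"
  unfolding euler_sum_def
proof (rule has_sum_infsum, rule summable_on_if_absv_le)
  show "(\<lambda>n. absv q ^ (n choose 2) * (absv (- x) * (1 / (1 - absv q))) ^ n) summable_on UNIV"
    by (rule summable_on_power_choose_two) (use assms in auto)
qed (rule absv_euler_term_le[OF assms])

text \<open>In the termwise difference of the series at \<open>x\<close> and at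
  \<open>x * q\<close>, the factor \<open>1 - q ^ Suc n\<close> cancels against \<open>qinv\<close>;
  what remains is \<open>- x\<close> times the series at \<open>x * q\<close>, shifted by one
  index.\<close>

lemma euler_sum_rec:
  assumes q: "absv q < 1"
  shows "euler_sum q x = (1 - x) * euler_sum q (x * q)"
proof -
  define e where "e y n = q ^ (n choose 2) * (- y) ^ n * qinv q n" for y n
  have e: "(e y has_sum euler_sum q y) UNIV" for y
    unfolding e_def by (rule has_sum_euler_sum[OF q])
  have scale: "(- (x * q)) ^ n = (- x) ^ n * q ^ n" for n
    using power_mult_distrib[of "- x" q n] by simp
  have Suc: "e x (Suc n) - e (x * q) (Suc n) = - x * e (x * q) n" for n
  proof -
    have "e x (Suc n) - e (x * q) (Suc n)
        = q ^ (Suc n choose 2) * (- x) ^ Suc n * ((1 - q ^ Suc n) * qinv q (Suc n))"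
      unfolding e_def scale by (simp only: algebra_simps mult_1_left)
    also have "\<dots> = - x * e (x * q) n"
      unfolding qinv_Suc[OF q] unfolding e_def scale choose_two_Suc power_add power_Suc by (simp only: mult_ac)
    finally show ?thesis .
  qed
  have "((\<lambda>n. e x n - e (x * q) n) has_sum (e x 0 - e (x * q) 0 + - x * euler_sum q (x * q))) UNIV"
    by (rule has_sum_Suc) (unfold Suc, rule has_sum_cmult_right[OF e])
  moreover
  have "((\<lambda>n. e x n + - 1 * e (x * q) n) has_sum
      (euler_sum q x + - 1 * euler_sum q (x * q))) UNIV"
    by (intro has_sum_add has_sum_cmult_right e)
  then have "((\<lambda>n. e x n - e (x * q) n) has_sum (euler_sum q x - euler_sum q (x * q))) UNIV"
    by simp
  ultimately have "e x 0 - e (x * q) 0 + - x * euler_sum q (x * q)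
      = euler_sum q x - euler_sum q (x * q)"
    by (rule has_sum_unique)
  then show ?thesis
    by (simp add: e_def algebra_simps)
qed

lemma euler_sum_split:
  assumes "absv q < 1"
  shows "euler_sum q x = qpoch x q n * euler_sum q (x * q ^ n)"
proof (induction n)
  case (Suc n)
  then show ?case
    using euler_sum_rec[OF assms, of "x * q ^ n"] by (simp add: qpoch_Suc mult_ac)
qed simp

text \<open>Apart from the constant term 1, the term of index \<open>k\<close> carries
  \<open>(q ^ n) ^ k\<close> with \<open>k > 0\<close>, so one factor \<open>absv q ^ n\<close>
  comes out in front of a majorant independent of \<open>n\<close>.\<close>

lemma euler_sum_tendsto_1:
  assumes q: "absv q < 1"
  shows "(\<lambda>n. euler_sum q (x * q ^ n)) \<longlonglongrightarrow> 1"
proof -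
  define K where "K = absv x * (1 / (1 - absv q))"
  define g where "g n = absv q ^ (n choose 2) * K ^ n" for n
  have K: "K \<ge> 0"
    unfolding K_def using q by simp
  obtain G where G: "(g has_sum G) UNIV"
    using summable_on_power_choose_two[of "absv q" K] q K unfolding g_def summable_on_def by auto
  have bound: "absv (euler_sum q (x * q ^ n) - 1) \<le> absv q ^ n * G" for n
  proof (rule absv_has_sum_le)
    define e where "e k = q ^ (k choose 2) * (- (x * q ^ n)) ^ k * qinv q k" for k
    \<comment> \<open>The added sequence cancels the constant term of the series.\<close>
    have "((\<lambda>k. if k = 0 then - 1 else 0 :: 'a) has_sum - 1) UNIV"
      by (rule has_sum_finite_neutralI[of "{0}"]) auto
    then have "((\<lambda>k. e k + (if k = 0 then - 1 else 0)) has_sum (euler_sum q (x * q ^ n) + - 1)) UNIV"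
      unfolding e_def by (intro has_sum_add has_sum_euler_sum q)
    then show "((\<lambda>k. e k + (if k = 0 then - 1 else 0)) has_sum (euler_sum q (x * q ^ n) - 1)) UNIV"
      by simp
    show "((\<lambda>k. absv q ^ n * g k) has_sum (absv q ^ n * G)) UNIV"
      by (rule has_sum_cmult_right[OF G])
    fix k
    show "absv (e k + (if k = 0 then - 1 else 0)) \<le> absv q ^ n * g k"
    proof (cases "k = 0")
      case False
      have "absv (e k) \<le> absv q ^ (k choose 2) * (absv q ^ n * K) ^ k"
        using absv_euler_term_le[OF q, of k "- (x * q ^ n)"]
        by (simp add: e_def K_def absv_mult absv_power mult_ac)
      also have "\<dots> = (absv q ^ n) ^ k * g k"
        by (simp add: g_def power_mult_distrib)
      also have "\<dots> \<le> (absv q ^ n) ^ 1 * g k"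
        using False q K by (intro mult_right_mono power_decreasing) (auto simp: g_def power_le_one)
      finally show ?thesis
        using False by simp
    qed (use q K in \<open>simp add: e_def g_def binomial_eq_0\<close>)
  qed
  have lim: "(\<lambda>n. absv q ^ n * G) \<longlonglongrightarrow> 0"
    using q by (intro tendsto_mult_left_zero LIMSEQ_power_zero) auto
  have "(\<lambda>n. absv (euler_sum q (x * q ^ n) - 1)) \<longlonglongrightarrow> 0"
    by (rule tendsto_sandwich[OF _ _ tendsto_const lim]; intro always_eventually allI bound absv_nonneg)
  then show ?thesis
    by (subst tendsto_dist_iff) (simp add: dist_absv)
qed

text \<open>By \<open>euler_sum_split\<close> the series is \<open>qpoch x q n * E n\<close> with
  \<open>E n\<close> tending to 1. Instead of dividing by \<open>E n\<close>, the proof bounds the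
  finite products through \<open>absv (E n) \<ge> 1 / 2\<close>.\<close>

lemma qpoch_tendsto_euler_sum:
  assumes q: "absv q < 1"
  shows "(\<lambda>n. qpoch x q n) \<longlonglongrightarrow> euler_sum q x"
proof -
  define E where "E n = euler_sum q (x * q ^ n)" for n
  have E: "E \<longlonglongrightarrow> 1"
    unfolding E_def by (rule euler_sum_tendsto_1[OF q])
  have E0: "euler_sum q x = qpoch x q n * E n" for n
    unfolding E_def by (rule euler_sum_split[OF q])
  have lim: "(\<lambda>n. dist (E n) 1) \<longlonglongrightarrow> 0"
    using E by (rule iffD1[OF tendsto_dist_iff])
  have "\<forall>\<^sub>F n in sequentially. dist (E n) 1 < 1 / 2"
    using lim by (rule order_tendstoD) simp
  then have le: "\<forall>\<^sub>F n in sequentially. dist (qpoch x q n) (euler_sum q x)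
      \<le> 2 * absv (euler_sum q x) * dist (E n) 1"
  proof eventually_elim
    case (elim n)
    have "absv (E n) \<ge> 1 / 2"
      using elim absv_one_minus_ge[of "1 - E n"] absv_minus[of "1 - E n"] by (simp add: dist_absv)
    then have "absv (qpoch x q n) * (1 / 2) \<le> absv (qpoch x q n) * absv (E n)"
      by (rule mult_left_mono) simp
    then have le: "absv (qpoch x q n) \<le> 2 * absv (euler_sum q x)"
      unfolding E0[of n] absv_mult by simp
    have "qpoch x q n - euler_sum q x = qpoch x q n * (1 - E n)"
      by (simp add: E0[of n] algebra_simps)
    then have "dist (qpoch x q n) (euler_sum q x) = absv (qpoch x q n) * dist (E n) 1"
      by (simp only: dist_commute[of _ 1]) (simp add: dist_absv absv_mult)
    then show ?case
      using mult_right_mono[OF le, of "dist (E n) 1"] by simp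
  qed
  have "(\<lambda>n. dist (qpoch x q n) (euler_sum q x)) \<longlonglongrightarrow> 0"
    by (rule tendsto_sandwich[OF _ le tendsto_const tendsto_mult_right_zero[OF lim]])
       (intro always_eventually allI zero_le_dist)
  then show ?thesis
    by (rule iffD2[OF tendsto_dist_iff])
qed

text \<open>The tail \<open>euler_sum q (x * q ^ n)\<close> tends to 1, hence is nonzero for some
  \<open>n\<close>, and no factor in front of it vanishes.\<close>

lemma euler_sum_nonzero:
  assumes "absv q < 1" "absv x < 1"
  shows "euler_sum q x \<noteq> 0"
proof -
  have "\<forall>\<^sub>F n in sequentially. euler_sum q (x * q ^ n) \<noteq> 0"
    using tendsto_imp_eventually_ne[OF euler_sum_tendsto_1[OF assms(1)]] by simp
  then obtain n where "euler_sum q (x * q ^ n) \<noteq> 0"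
    by (auto simp: eventually_sequentially)
  then show ?thesis
    using euler_sum_split[OF assms(1), of x n] qpoch_nonzero[OF assms(2,1), of n] by simp
qed

text \<open>\<open>raw_has_prod\<close> demands a nonzero limit, which is where
  \<open>absv x < 1\<close> enters.\<close>

lemma qpoch_inf_eq_euler_sum:
  assumes "absv q < 1" "absv x < 1"
  shows "qpoch_inf x q = euler_sum q x"
proof -
  \<comment> \<open>\<open>raw_has_prod\<close> multiplies the factors up to and including
    \<open>n\<close>, while \<open>qpoch\<close> stops before \<open>n\<close>.\<close>
  have "(\<lambda>n. \<Prod>j\<le>n. 1 - x * q ^ j) \<longlonglongrightarrow> euler_sum q x"
    using LIMSEQ_Suc[OF qpoch_tendsto_euler_sum[OF assms(1), of x]]
    by (simp add: qpoch_def lessThan_Suc_atMost)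
  then have "(\<lambda>j. 1 - x * q ^ j) has_prod euler_sum q x"
    using euler_sum_nonzero[OF assms] by (simp add: has_prod_def raw_has_prod_def)
  then show ?thesis
    unfolding qpoch_inf_def by (rule has_prod_unique[symmetric])
qed

section \<open>Finite identities\<close>

text \<open>
  Cauchy's expansion of \<open>x^j\<close> in the polynomials \<open>(x - 1)(x - q)\<dots>(x - q^(n-1))\<close>, at \<open>x = q^i\<close>.
\<close>
lemma qinv_product_expansion:
  assumes q: "absv q < 1"
  shows "q ^ (i * j) * qinv q i * qinv q j =
    (\<Sum>n\<le>min i j. (- 1) ^ n * q ^ (n choose 2) * qinv q n * qinv q (i - n) * qinv q (j - n))"
proof -
  \<comment> \<open>Truncated subtraction would give \<open>qinv q 0 = 1\<close> for
    \<open>n > k\<close>; the zero lets all sums over \<open>n\<close> run up to \<open>i\<close>,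
    whatever \<open>j\<close> is.\<close>
  define s where "s k n = (if n \<le> k then qinv q (k - n) else 0)" for k n
  define T where "T i j n = (- 1) ^ n * q ^ (n choose 2) * qinv q n * s i n * s j n" for i j n
  define R where "R i j = (\<Sum>n\<le>i. T i j n)" for i j
  \<comment> \<open>The closed form obeys the same recursion, so agreement at \<open>i = 0\<close>
    and at \<open>j = 0\<close> suffices.\<close>
  have rec: "(1 - q ^ Suc i) * R (Suc i) (Suc j) = R i (Suc j) - q ^ i * R i j" for i j
  proof -
    \<comment> \<open>The split is \<open>1 - q ^ Suc i = (1 - q ^ (Suc i - n)) + q ^ (Suc i - n) *
      (1 - q ^ n)\<close>: the first part lowers the index of \<open>qinv q (Suc i - n)\<close>, the
      second, giving \<open>U\<close>, that of \<open>qinv q n\<close>.\<close>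
    define U where "U n = q ^ (Suc i - n) * (1 - q ^ n) * T (Suc i) (Suc j) n" for n
    have split: "(1 - q ^ Suc i) * T (Suc i) (Suc j) n = T i (Suc j) n + U n" if "n \<le> Suc i" for n
    proof -
      have "q ^ Suc i = q ^ (Suc i - n) * q ^ n"
        using that by (metis le_add_diff_inverse2 power_add)
      then have "(1 - q ^ Suc i) * T (Suc i) (Suc j) n
          = (1 - q ^ (Suc i - n)) * T (Suc i) (Suc j) n + U n"
        by (simp add: U_def algebra_simps del: power_Suc)
      moreover have "(1 - q ^ (Suc i - n)) * s (Suc i) n = s i n"
      proof (cases "n = Suc i")
        case False
        then show ?thesis
          using that qinv_Suc[OF q, of "i - n"] by (simp add: s_def Suc_diff_le)
      qed (simp add: s_def)
      then have "(1 - q ^ (Suc i - n)) * T (Suc i) (Suc j) n = T i (Suc j) n"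
        unfolding T_def by (metis mult.assoc mult.left_commute)
      ultimately show ?thesis
        by simp
    qed
    have U_Suc: "U (Suc n) = - (q ^ i * T i j n)" if "n \<le> i" for n
    proof -
      have "U (Suc n) = q ^ (i - n) * ((1 - q ^ Suc n) * qinv q (Suc n))
          * ((- 1) ^ Suc n * q ^ (Suc n choose 2) * s i n * s j n)"
        by (simp add: U_def T_def s_def mult_ac)
      also have "\<dots> = - (q ^ (i - n) * q ^ n * T i j n)"
        unfolding qinv_Suc[OF q] by (simp add: T_def choose_two_Suc power_add mult_ac)
      also have "q ^ (i - n) * q ^ n = q ^ i"
        using that by (simp flip: power_add)
      finally show ?thesis .
    qed
    have "(1 - q ^ Suc i) * R (Suc i) (Suc j) = (\<Sum>n\<le>Suc i. T i (Suc j) n + U n)"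
      unfolding R_def sum_distrib_left by (intro sum.cong refl split) simp
    also have "\<dots> = (\<Sum>n\<le>Suc i. T i (Suc j) n) + (\<Sum>n\<le>Suc i. U n)"
      by (rule sum.distrib)
    also have "(\<Sum>n\<le>Suc i. T i (Suc j) n) = R i (Suc j)"
      by (simp add: R_def T_def s_def)
    also have "(\<Sum>n\<le>Suc i. U n) = U 0 + (\<Sum>n\<le>i. U (Suc n))"
      by (rule sum.atMost_Suc_shift)
    also have "\<dots> = - (q ^ i * R i j)"
      using U_Suc by (simp add: R_def sum_distrib_left sum_negf U_def)
    finally show ?thesis
      by simp
  qed
  have "R i j = q ^ (i * j) * qinv q i * qinv q j" for i j
  proof (induction i arbitrary: j)
    case 0
    then show ?case
      by (simp add: R_def T_def s_def numeral_2_eq_2)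
  next
    case (Suc i)
    show ?case
    proof (cases j)
      case 0
      have "R (Suc i) 0 = T (Suc i) 0 0"
        unfolding R_def by (rule sum.remove[of _ 0, THEN trans]) (auto simp: T_def s_def)
      then show ?thesis
        using 0 by (simp add: T_def s_def numeral_2_eq_2)
    next
      case (Suc k)
      have "(1 - q ^ Suc i) * R (Suc i) j
          = q ^ (i * Suc k) * qinv q i * qinv q (Suc k) - q ^ i * (q ^ (i * k) * qinv q i * qinv q k)"
        using rec[of i k] Suc.IH Suc by simp
      also have "\<dots> = q ^ (i * Suc k) * q ^ Suc k * qinv q i * qinv q (Suc k)"
        unfolding qinv_Suc[OF q, of k, symmetric] by (simp add: algebra_simps power_add)
      also have "\<dots> = (1 - q ^ Suc i) * (q ^ (Suc i * Suc k) * qinv q (Suc i) * qinv q (Suc k))"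
        unfolding qinv_Suc[OF q, of i, symmetric] by (simp add: power_add mult_ac)
      finally have "(1 - q ^ Suc i) * R (Suc i) j
          = (1 - q ^ Suc i) * (q ^ (Suc i * j) * qinv q (Suc i) * qinv q j)"
        using Suc by simp
      moreover have "1 - q ^ Suc i \<noteq> 0"
        using qpoch_nonzero[OF q q, of "Suc i"] by (auto simp: qpoch_Suc)
      ultimately show ?thesis
        by simp
    qed
  qed
  moreover have "R i j = (\<Sum>n\<le>min i j. T i j n)"
    unfolding R_def by (rule sum.mono_neutral_right) (auto simp: T_def s_def)
  ultimately show ?thesis
    by (simp add: T_def s_def)
qed

section \<open>Power series in an auxiliary variable and the cubic coefficient identity\<close>

text \<open>Substitutes \<open>q z\<close> for the auxiliary variable \<open>z\<close>; here
  \<open>q\<close> is a scalar of the coefficient ring, which may itself consist of power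
  series.\<close>

definition fps_dilate :: "'a::comm_ring_1 \<Rightarrow> 'a fps \<Rightarrow> 'a fps" where
  "fps_dilate q f = Abs_fps (\<lambda>n. q ^ n * fps_nth f n)"

lemma fps_dilate_nth [simp]: "fps_nth (fps_dilate q f) n = q ^ n * fps_nth f n"
  by (simp add: fps_dilate_def)

lemma fps_dilate_mult: "fps_dilate q (f * g) = fps_dilate q f * fps_dilate q g"
proof (rule fps_ext)
  fix n
  have "q ^ n * (fps_nth f i * fps_nth g (n - i)) = q ^ i * fps_nth f i * (q ^ (n - i) * fps_nth g (n - i))"
    if "i \<in> {0..n}" for i
  proof -
    have "q ^ n = q ^ i * q ^ (n - i)"
      using that by (simp flip: power_add)
    then show ?thesis
      by (simp add: mult_ac)
  qed
  then show "fps_nth (fps_dilate q (f * g)) n = fps_nth (fps_dilate q f * fps_dilate q g) n"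
    by (simp add: fps_mult_nth sum_distrib_left)
qed

text \<open>The difference \<open>d\<close> solves the same linear equation with zero constant term.
  Comparing coefficients expresses \<open>(1 - q ^ n) * fps_nth d n\<close> through lower ones, and
  \<open>1 - q ^ n\<close> is nonzero for \<open>n > 0\<close>.\<close>

lemma fps_dilate_eq_unique:
  fixes f g :: "'a::valued_idom fps"
  assumes q: "absv q < 1"
    and f: "f * (1 + fps_X ^ 3) = (1 + fps_X) * fps_dilate q f"
    and g: "g * (1 + fps_X ^ 3) = (1 + fps_X) * fps_dilate q g"
    and 0: "fps_nth f 0 = fps_nth g 0"
  shows "f = g"
proof -
  define d where "d = f - g"
  have "fps_dilate q d = fps_dilate q f - fps_dilate q g"
    by (rule fps_ext) (simp add: d_def algebra_simps)
  then have "d * (1 + fps_X ^ 3) = (1 + fps_X) * fps_dilate q d"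
    by (simp only: d_def left_diff_distrib right_diff_distrib f g)
  then have eq: "d + d * fps_X ^ 3 = fps_dilate q d + fps_X * fps_dilate q d"
    by (simp add: distrib_left distrib_right)
  have "fps_nth d n = 0" for n
  proof (induction n rule: less_induct)
    case (less n)
    show ?case
    proof (cases n)
      case 0
      then show ?thesis
        using assms(4) by (simp add: d_def)
    next
      case (Suc k)
      have "fps_nth (d + d * fps_X ^ 3) n = fps_nth (fps_dilate q d + fps_X * fps_dilate q d) n"
        using eq by simp
      then have "(1 - q ^ Suc k) * fps_nth d n = 0"
        using less Suc by (simp add: fps_X_power_mult_right_nth algebra_simps split: if_splits)
      moreover have "1 - q ^ Suc k \<noteq> 0"
        using qpoch_nonzero[OF q q, of "Suc k"] by (auto simp: qpoch_Suc)
      ultimately show ?thesis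
        by simp
    qed
  qed
  then show ?thesis
    by (simp add: fps_eq_iff d_def)
qed

lemma cube_root_of_unity:
  fixes w :: "'a::comm_ring_1"
  assumes "1 + w + w ^ 2 = 0"
  shows "w ^ 3 = 1"
proof -
  have "w ^ 3 - 1 = (w - 1) * (1 + w + w ^ 2)"
    by (simp add: algebra_simps power2_eq_square power3_eq_cube)
  then show ?thesis
    using assms by simp
qed

text \<open>
  Both sides are coefficients of \<open>(-z; q)\<^sub>\<infinity> / (-z\<^sup>3; q\<^sup>3)\<^sub>\<infinity> = 1 / ((-wz; q)\<^sub>\<infinity> (-w\<^sup>2z; q)\<^sub>\<infinity>)\<close>;
  this series \<open>f\<close> in \<open>z\<close> is pinned down by its value at 0 and the equation
  \<open>(1 + z\<^sup>3) f(z) = (1 + z) f(qz)\<close>.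
\<close>
lemma cubic_coefficient_identity:
  fixes q w :: "'a::valued_idom"
  assumes q: "absv q < 1" and w: "1 + w + w ^ 2 = 0"
  shows "(\<Sum>(m, n) | m + 3 * n = N. (- 1) ^ n * q ^ (m choose 2) * qinv q m * qinv (q ^ 3) n)
    = (\<Sum>(i, j) | i + j = N. (- w) ^ i * (- (w ^ 2)) ^ j * qinv q i * qinv q j)"
proof -
  \<comment> \<open>As series in \<open>z\<close>, \<open>e y\<close> is
    \<open>1 / (y z; q)_infinity\<close>, \<open>B\<close> is \<open>(- z; q)_infinity\<close> and
    \<open>D\<close> is \<open>1 / (- z^3; q^3)_infinity\<close>; the proof works with their
    equations under \<open>z -> q z\<close>.\<close>
  define e where "e y = Abs_fps (\<lambda>n. y ^ n * qinv q n)" for y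
  define B where "B = Abs_fps (\<lambda>m. q ^ (m choose 2) * qinv q m)"
  define D where "D = Abs_fps (\<lambda>k. if 3 dvd k then (- 1) ^ (k div 3) * qinv (q ^ 3) (k div 3) else 0)"
  have q3: "absv (q ^ 3) < 1"
    using q by (simp add: absv_power power_less_one_iff)
  have e: "e y * (1 - fps_const y * fps_X) = fps_dilate q (e y)" for y
  proof (rule fps_ext)
    fix n
    have expand: "e y * (1 - fps_const y * fps_X) = e y - fps_const y * (e y * fps_X)"
      by (simp only: right_diff_distrib mult_1_right mult.left_commute)
    show "fps_nth (e y * (1 - fps_const y * fps_X)) n = fps_nth (fps_dilate q (e y)) n"
    proof (cases n)
      case (Suc k)
      have "fps_nth (e y * (1 - fps_const y * fps_X)) n = y ^ Suc k * qinv q (Suc k) - y * (y ^ k * qinv q k)"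
        unfolding expand using Suc by (simp add: e_def)
      also have "\<dots> = q ^ Suc k * (y ^ Suc k * qinv q (Suc k))"
        unfolding qinv_Suc[OF q, of k, symmetric] by (simp add: algebra_simps)
      finally show ?thesis
        using Suc by (simp add: e_def)
    qed (simp add: e_def expand)
  qed
  have B: "B = (1 + fps_X) * fps_dilate q B"
  proof (rule fps_ext)
    fix n
    show "fps_nth B n = fps_nth ((1 + fps_X) * fps_dilate q B) n"
    proof (cases n)
      case (Suc k)
      have "q ^ (Suc k choose 2) * qinv q (Suc k)
          = q ^ Suc k * (q ^ (Suc k choose 2) * qinv q (Suc k)) + q ^ k * (q ^ (k choose 2) * qinv q k)"
        unfolding qinv_Suc[OF q, of k, symmetric] by (simp add: choose_two_Suc power_add algebra_simps)
      then show ?thesis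
        using Suc by (simp add: B_def distrib_right)
    qed (simp add: B_def distrib_right)
  qed
  have D: "D * (1 + fps_X ^ 3) = fps_dilate q D"
  proof (rule fps_ext)
    fix n :: nat
    consider "n < 3" | k where "n = k + 3"
      using le_add_diff_inverse2[of 3 n] not_less by metis
    then show "fps_nth (D * (1 + fps_X ^ 3)) n = fps_nth (fps_dilate q D) n"
    proof cases
      case 1
      then have "n = 0 \<or> n = 1 \<or> n = 2"
        by auto
      then show ?thesis
        by (auto simp: D_def distrib_left fps_X_power_mult_right_nth)
    next
      case (2 k)
      show ?thesis
      proof (cases "3 dvd k")
        case True
        then obtain l where l: "k = 3 * l"
          by blast
        have "(- 1) ^ Suc l * qinv (q ^ 3) (Suc l) + (- 1) ^ l * qinv (q ^ 3) l
            = (q ^ 3) ^ Suc l * ((- 1) ^ Suc l * qinv (q ^ 3) (Suc l))"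
          unfolding qinv_Suc[OF q3, of l, symmetric] by (simp add: algebra_simps)
        moreover have "(q ^ 3) ^ Suc l = q ^ n"
          using 2 l by (simp add: power_add flip: power_mult)
        moreover have "n div 3 = Suc l" "3 dvd n" "k div 3 = l"
          using 2 l by auto
        ultimately show ?thesis
          using 2 True by (simp add: D_def distrib_left fps_X_power_mult_right_nth)
      next
        case False
        then have "\<not> 3 dvd n"
          using 2 by simp
        then show ?thesis
          using 2 False by (simp add: D_def distrib_left fps_X_power_mult_right_nth)
      qed
    qed
  qed
  have w3: "w * w ^ 2 = 1"
    using cube_root_of_unity[OF w] by (simp add: power2_eq_square power3_eq_cube mult_ac)
  have ww: "w + w ^ 2 = - 1"
    using w by (simp add: eq_neg_iff_add_eq_0 add_ac)
  \<comment> \<open>\<open>1 - z + z^2\<close> is the cofactor of \<open>1 + z\<close> in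
    \<open>1 + z^3\<close>; this gives the product of the two \<open>e\<close> the same equation as
    \<open>B * D\<close>.\<close>
  have factor: "(1 - fps_const (- w) * fps_X) * (1 - fps_const (- (w ^ 2)) * fps_X) = 1 - fps_X + fps_X ^ 2"
  proof -
    have "(1 - fps_const (- w) * fps_X) * (1 - fps_const (- (w ^ 2)) * fps_X)
        = 1 + fps_const (w + w ^ 2) * fps_X + fps_const (w * w ^ 2) * fps_X ^ 2"
      unfolding fps_const_add[symmetric] fps_const_mult[symmetric] fps_const_neg[symmetric]
      by (simp add: algebra_simps power2_eq_square del: fps_const_neg fps_const_add fps_const_mult)
    then show ?thesis
      by (simp only: ww w3) (simp flip: fps_const_neg)
  qed
  have "B * D = e (- w) * e (- (w ^ 2))"
  proof (rule fps_dilate_eq_unique[OF q])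
    show "B * D * (1 + fps_X ^ 3) = (1 + fps_X) * fps_dilate q (B * D)"
      unfolding fps_dilate_mult D[symmetric] by (subst B) (simp only: mult_ac)
    have "e (- w) * e (- (w ^ 2)) * (1 - fps_X + fps_X ^ 2) = fps_dilate q (e (- w) * e (- (w ^ 2)))"
      unfolding factor[symmetric] fps_dilate_mult e[symmetric] by (simp only: mult_ac)
    moreover have cube: "1 + fps_X ^ 3 = (1 - fps_X + fps_X ^ 2) * (1 + fps_X :: 'a fps)"
      by (simp add: algebra_simps power2_eq_square power3_eq_cube)
    ultimately show "e (- w) * e (- (w ^ 2)) * (1 + fps_X ^ 3)
        = (1 + fps_X) * fps_dilate q (e (- w) * e (- (w ^ 2)))"
      unfolding cube by (simp only: mult.assoc[symmetric]) (simp only: mult.commute)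
  qed (simp add: B_def D_def e_def numeral_2_eq_2)
  then have "fps_nth (B * D) N = fps_nth (e (- w) * e (- (w ^ 2))) N"
    by simp
  also have "fps_nth (e (- w) * e (- (w ^ 2))) N
      = (\<Sum>(i, j) | i + j = N. (- w) ^ i * (- (w ^ 2)) ^ j * qinv q i * qinv q j)"
    unfolding fps_mult_nth e_def
    by (rule sum.reindex_bij_witness[of _ fst "\<lambda>i. (i, N - i)"]) (auto simp: mult_ac)
  also have "fps_nth (B * D) N = (\<Sum>i | i \<le> N \<and> 3 dvd N - i. fps_nth B i * fps_nth D (N - i))"
    unfolding fps_mult_nth by (rule sum.mono_neutral_right) (auto simp: D_def)
  also have "\<dots> = (\<Sum>(m, n) | m + 3 * n = N. (- 1) ^ n * q ^ (m choose 2) * qinv q m * qinv (q ^ 3) n)"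
    by (rule sum.reindex_bij_witness[of _ fst "\<lambda>i. (i, (N - i) div 3)"])
       (auto simp: B_def D_def mult_ac)
  finally show ?thesis .
qed

text \<open>Factor by factor this is \<open>(1 - y) (1 - w y) (1 - w^2 y) = 1 - y^3\<close> with
  \<open>y = q ^ Suc j\<close>.\<close>

lemma qpoch_cube_product:
  fixes q w :: "'a::valued_idom"
  assumes w: "1 + w + w ^ 2 = 0"
  shows "qpoch q q n * qpoch (w * q) q n * qpoch (w ^ 2 * q) q n = qpoch (q ^ 3) (q ^ 3) n"
proof -
  note w3 = cube_root_of_unity[OF w]
  have "(1 - y) * (1 - w * y) * (1 - w ^ 2 * y) = 1 - y ^ 3" for y
  proof -
    have "(1 - y) * (1 - w * y) * (1 - w ^ 2 * y)
        = 1 - (1 + w + w ^ 2) * y + (1 + w + w ^ 2) * w * y ^ 2 - w ^ 3 * y ^ 3"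
      by (simp add: algebra_simps power2_eq_square power3_eq_cube)
    then show ?thesis
      by (simp add: w w3)
  qed
  moreover have "(q * q ^ j) ^ 3 = q ^ 3 * (q ^ 3) ^ j" for j
    by (simp add: power_mult_distrib mult.commute flip: power_mult)
  ultimately have "(1 - q * q ^ j) * (1 - w * q * q ^ j) * (1 - w ^ 2 * q * q ^ j) = 1 - q ^ 3 * (q ^ 3) ^ j" for j
    by (simp only: mult.assoc)
  then show ?thesis
    unfolding qpoch_def by (simp flip: prod.distrib)
qed

text \<open>The exponents from 1 to \<open>3 * n\<close> are sorted by residue modulo 3.\<close>

lemma qpoch_trisect:
  "qpoch q q (3 * n) = qpoch q (q ^ 3) n * qpoch (q ^ 2) (q ^ 3) n * qpoch (q ^ 3) (q ^ 3) n"
proof (induction n)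
  case (Suc n)
  have "3 * Suc n = Suc (Suc (Suc (3 * n)))"
    by simp
  moreover have "q * q ^ Suc (3 * n) = q ^ 2 * (q ^ 3) ^ n" "q * q ^ Suc (Suc (3 * n)) = q ^ 3 * (q ^ 3) ^ n"
    "q * q ^ (3 * n) = q * (q ^ 3) ^ n"
    unfolding power_mult[symmetric]
    by (simp_all only: power2_eq_square power3_eq_cube power_Suc mult.assoc)
  ultimately show ?case
    using Suc by (simp only: qpoch_Suc mult_ac)
qed simp

section \<open>The double sum\<close>

text \<open>The pairs \<open>(h x, x)\<close> reindex the sum over the disjoint union of the fibres
  of \<open>h\<close>, where the summation can be iterated; finite fibres make the inner sums
  finite.\<close>

lemma has_sum_fibres:
  fixes f :: "'b \<Rightarrow> 'a::valued_idom"
  assumes "(f has_sum S) UNIV" and "\<And>y. finite {x. h x = y}"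
  shows "((\<lambda>y. \<Sum>x | h x = y. f x) has_sum S) UNIV"
proof (rule has_sum_SigmaD)
  have "((\<lambda>(y, x). f x) has_sum S) (SIGMA y:UNIV. {x. h x = y}) \<longleftrightarrow> (f has_sum S) UNIV"
    by (rule has_sum_reindex_bij_witness[of _ "\<lambda>x. (h x, x)" snd]) auto
  then show "((\<lambda>(y, x). f x) has_sum S) (SIGMA y:UNIV. {x. h x = y})"
    using assms(1) by simp
qed (use assms(2) in simp)

lemma has_sum_product:
  fixes f :: "'b \<Rightarrow> 'a::valued_idom" and g :: "'c \<Rightarrow> 'a"
  assumes f: "(f has_sum S) A" and g: "(g has_sum T) B"
    and summable: "(\<lambda>(x, y). f x * g y) summable_on A \<times> B"
  shows "((\<lambda>(x, y). f x * g y) has_sum (S * T)) (A \<times> B)"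
proof (rule has_sum_SigmaI)
  show "((\<lambda>y. (\<lambda>(x, y). f x * g y) (x, y)) has_sum f x * T) B" for x
    using has_sum_cmult_right[OF g] by simp
  show "((\<lambda>x. f x * T) has_sum S * T) A"
    by (rule has_sum_cmult_left[OF f])
qed (rule summable)

context
  fixes q w :: "'a::valued_idom"
  assumes q: "absv q < 1" and w: "1 + w + w ^ 2 = 0"
begin

lemma absv_root: "absv w = 1"
proof -
  have "absv w ^ 3 = 1"
    by (simp add: cube_root_of_unity[OF w] flip: absv_power)
  then show ?thesis
    using power_eq_imp_eq_base[of "absv w" 3 1] by simp
qed

lemma absv_q3: "absv (q ^ 3) < 1"
  using q by (simp add: absv_power power_less_one_iff)

text \<open>Dominates every single-index factor of the double and triple sums, so that products of
  its values settle their summability.\<close>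

definition majorant :: "nat \<Rightarrow> real" where
  "majorant n = absv q ^ (n choose 2) * (1 / (1 - absv q)) ^ n"

lemma majorant_nonneg: "majorant n \<ge> 0"
  using q by (simp add: majorant_def)

lemma majorant_summable: "majorant summable_on UNIV"
  unfolding majorant_def by (rule summable_on_power_choose_two) (use q in auto)

lemma majorant_prod_summable: "(\<lambda>(m, n). majorant m * majorant n) summable_on UNIV"
  using summable_on_mult_Times[OF majorant_summable majorant_summable] by (simp add: majorant_nonneg)

lemma absv_power_qinv_le_majorant:
  assumes "n choose 2 \<le> e"
  shows "absv (q ^ e * qinv q n) \<le> majorant n"
  unfolding majorant_def absv_mult absv_power
  by (intro mult_mono power_decreasing assms absv_qinv_le q) (use q in auto)

lemma absv_euler_term_le_majorant:
  assumes "absv x \<le> 1"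
  shows "absv (q ^ (n choose 2) * x ^ n * qinv q n) \<le> majorant n"
proof -
  have "absv x ^ n \<le> 1"
    using assms by (simp add: power_le_one)
  then have "absv x ^ n * absv (q ^ (n choose 2) * qinv q n) \<le> 1 * majorant n"
    using absv_power_qinv_le_majorant[of n "n choose 2"] by (intro mult_mono) auto
  then show ?thesis
    by (simp add: absv_mult absv_power mult_ac)
qed

text \<open>Since \<open>absv (q ^ 3) \<le> absv q\<close>, the estimate for base
  \<open>q ^ 3\<close> weakens to that for base \<open>q\<close>, and \<open>majorant\<close> serves
  both.\<close>

lemma absv_qinv_cube_le:
  "absv (qinv (q ^ 3) n) \<le> (1 / (1 - absv q)) ^ n"
proof -
  have "absv q ^ 3 \<le> absv q ^ 1"
    using q by (intro power_decreasing) auto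
  then have "1 / (1 - absv (q ^ 3)) \<le> 1 / (1 - absv q)"
    using q by (intro divide_left_mono mult_pos_pos) (auto simp: absv_power)
  then have "(1 / (1 - absv (q ^ 3))) ^ n \<le> (1 / (1 - absv q)) ^ n"
    using absv_q3 by (intro power_mono) auto
  then show ?thesis
    using absv_qinv_le[OF absv_q3, of n] by linarith
qed

section \<open>The triple sum\<close>

text \<open>Here \<open>n + a\<close> and \<open>n + b\<close> are the indices \<open>i\<close>,
  \<open>j\<close> before the expansion of \<open>q ^ (i * j)\<close>. For fixed \<open>n\<close>
  the factors in \<open>a\<close> and \<open>b\<close> are Euler terms at
  \<open>w * q ^ Suc n\<close> and \<open>w ^ 2 * q ^ Suc n\<close>.\<close>

definition triple_term :: "nat \<times> nat \<times> nat \<Rightarrow> 'a" where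
  "triple_term = (\<lambda>(n, a, b). (- 1) ^ n * q ^ (3 * (n choose 2) + 2 * n) * qinv q n
    * ((q ^ (a choose 2) * (- (w * q * q ^ n)) ^ a * qinv q a)
     * (q ^ (b choose 2) * (- (w ^ 2 * q * q ^ n)) ^ b * qinv q b)))"

lemma absv_argument_le: "absv (- (w ^ k * q * q ^ n)) \<le> 1"
proof -
  have "absv q ^ Suc n \<le> 1"
    using q by (intro power_le_one) auto
  then show ?thesis
    by (simp add: absv_mult absv_power absv_root)
qed

lemma euler_product_summable:
  "(\<lambda>(a, b). (q ^ (a choose 2) * (- (w * q * q ^ n)) ^ a * qinv q a)
     * (q ^ (b choose 2) * (- (w ^ 2 * q * q ^ n)) ^ b * qinv q b)) summable_on UNIV"
proof (rule summable_on_if_absv_le[OF majorant_prod_summable])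
  fix p :: "nat \<times> nat"
  obtain a b where p: "p = (a, b)"
    by (cases p)
  have "absv ((q ^ (a choose 2) * (- (w ^ 1 * q * q ^ n)) ^ a * qinv q a)
      * (q ^ (b choose 2) * (- (w ^ 2 * q * q ^ n)) ^ b * qinv q b)) \<le> majorant a * majorant b"
    unfolding absv_mult[of "_ * qinv q a"]
    by (intro mult_mono absv_euler_term_le_majorant absv_argument_le majorant_nonneg absv_nonneg)
  then show "absv (case p of (a, b) \<Rightarrow> (q ^ (a choose 2) * (- (w * q * q ^ n)) ^ a * qinv q a)
      * (q ^ (b choose 2) * (- (w ^ 2 * q * q ^ n)) ^ b * qinv q b))
      \<le> (case p of (a, b) \<Rightarrow> majorant a * majorant b)"
    by (simp add: p)
qed

lemma triple_term_summable: "triple_term summable_on UNIV"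
proof (rule summable_on_if_absv_le)
  show "(\<lambda>(n, ab). majorant n * (case ab of (a, b) \<Rightarrow> majorant a * majorant b)) summable_on UNIV"
    using summable_on_mult_Times[OF majorant_summable majorant_prod_summable]
    by (simp add: majorant_nonneg split_beta)
  fix x :: "nat \<times> nat \<times> nat"
  obtain n a b where x: "x = (n, a, b)"
    by (cases x) auto
  have "absv (triple_term (n, a, b)) = absv (q ^ (3 * (n choose 2) + 2 * n) * qinv q n)
      * (absv (q ^ (a choose 2) * (- (w ^ 1 * q * q ^ n)) ^ a * qinv q a)
       * absv (q ^ (b choose 2) * (- (w ^ 2 * q * q ^ n)) ^ b * qinv q b))"
    by (simp add: triple_term_def absv_mult absv_power)
  also have "\<dots> \<le> majorant n * (majorant a * majorant b)"
    by (intro mult_mono absv_euler_term_le_majorant absv_power_qinv_le_majorant absv_argument_le)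
       (simp_all add: majorant_nonneg)
  finally show "absv (triple_term x) \<le> (case x of (n, ab) \<Rightarrow> majorant n * (case ab of (a, b) \<Rightarrow> majorant a * majorant b))"
    by (simp add: x)
qed

text \<open>Passing to base \<open>q ^ 3\<close> produces exactly the finite products with which
  \<open>euler_sum_split\<close> frees both inner Euler sums from \<open>n\<close>.\<close>

lemma qinv_eq_qinv_cube:
  "qinv q n = qinv (q ^ 3) n * qpoch (w * q) q n * qpoch (w ^ 2 * q) q n"
proof -
  have "qinv q n = qinv q n * (qpoch (q ^ 3) (q ^ 3) n * qinv (q ^ 3) n)"
    by (simp add: qpoch_qinv[OF absv_q3])
  also have "\<dots> = (qpoch q q n * qinv q n) * (qinv (q ^ 3) n * qpoch (w * q) q n * qpoch (w ^ 2 * q) q n)"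
    unfolding qpoch_cube_product[OF w, symmetric] by (simp only: mult_ac)
  finally show ?thesis
    by (simp add: qpoch_qinv[OF q])
qed

text \<open>Summing over \<open>a\<close> and \<open>b\<close> first gives two Euler sums shifted by
  \<open>n\<close>; once the shifts are absorbed, the sum over \<open>n\<close> is Euler's series in
  base \<open>q ^ 3\<close> at \<open>q ^ 2\<close>.\<close>

lemma triple_term_has_sum:
  "(triple_term has_sum (euler_sum (q ^ 3) (q ^ 2) * (euler_sum q (w * q) * euler_sum q (w ^ 2 * q)))) UNIV"
proof -
  define c where "c n = (- 1) ^ n * q ^ (3 * (n choose 2) + 2 * n) * qinv q n" for n
  obtain S where S: "(triple_term has_sum S) UNIV"
    using triple_term_summable unfolding summable_on_def by blast
  have inner: "((\<lambda>ab. triple_term (n, ab)) has_sum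
      c n * (euler_sum q (w * q * q ^ n) * euler_sum q (w ^ 2 * q * q ^ n))) UNIV" for n
  proof -
    have "((\<lambda>(a, b). (q ^ (a choose 2) * (- (w * q * q ^ n)) ^ a * qinv q a)
        * (q ^ (b choose 2) * (- (w ^ 2 * q * q ^ n)) ^ b * qinv q b)) has_sum
        euler_sum q (w * q * q ^ n) * euler_sum q (w ^ 2 * q * q ^ n)) (UNIV \<times> UNIV)"
      by (intro has_sum_product has_sum_euler_sum q) (use euler_product_summable in simp)
    from has_sum_cmult_right[OF this, of "c n"] show ?thesis
      by (simp add: triple_term_def c_def split_beta)
  qed
  have "((\<lambda>n. c n * (euler_sum q (w * q * q ^ n) * euler_sum q (w ^ 2 * q * q ^ n))) has_sum S) UNIV"
    by (rule has_sum_SigmaD[OF _ inner]) (use S in simp)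
  moreover have "c n * (euler_sum q (w * q * q ^ n) * euler_sum q (w ^ 2 * q * q ^ n))
      = ((q ^ 3) ^ (n choose 2) * (- (q ^ 2)) ^ n * qinv (q ^ 3) n)
        * (euler_sum q (w * q) * euler_sum q (w ^ 2 * q))" for n
  proof -
    have "(- (q ^ 2)) ^ n = (- 1) ^ n * q ^ (2 * n)"
      by (subst power_minus) (simp add: power_mult)
    then show ?thesis
      unfolding c_def qinv_eq_qinv_cube[of n] euler_sum_split[OF q, of "w * q" n]
        euler_sum_split[OF q, of "w ^ 2 * q" n]
      by (simp only: power_add power_mult mult_ac)
  qed
  ultimately have "((\<lambda>n. ((q ^ 3) ^ (n choose 2) * (- (q ^ 2)) ^ n * qinv (q ^ 3) n)
        * (euler_sum q (w * q) * euler_sum q (w ^ 2 * q))) has_sum S) UNIV"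
    by simp
  moreover have "((\<lambda>n. ((q ^ 3) ^ (n choose 2) * (- (q ^ 2)) ^ n * qinv (q ^ 3) n)
        * (euler_sum q (w * q) * euler_sum q (w ^ 2 * q))) has_sum
      euler_sum (q ^ 3) (q ^ 2) * (euler_sum q (w * q) * euler_sum q (w ^ 2 * q))) UNIV"
    by (intro has_sum_cmult_left has_sum_euler_sum absv_q3)
  ultimately show ?thesis
    using S has_sum_unique by blast
qed

text \<open>In the fibre \<open>a = i - n\<close> and \<open>b = j - n\<close>, so the sum over
  \<open>n\<close> is that of \<open>qinv_product_expansion\<close>; its \<open>q ^ (i * j)\<close>
  completes the exponent to one depending on \<open>i + j\<close> only.\<close>

lemma triple_term_fibre_sum:
  "(\<Sum>t | (case t of (n, a, b) \<Rightarrow> (n + a, n + b)) = (i, j). triple_term t)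
    = q ^ (Suc (i + j) choose 2) * ((- w) ^ i * (- (w ^ 2)) ^ j * qinv q i * qinv q j)"
proof -
  have split: "triple_term (n, a, b) = q ^ (((n + a) choose 2) + ((n + b) choose 2) + (n + a) + (n + b))
      * ((- w) ^ (n + a) * (- (w ^ 2)) ^ (n + b))
      * ((- 1) ^ n * q ^ (n choose 2) * qinv q n * qinv q a * qinv q b)" for n a b
  proof -
    have arg: "(- (v * q * q ^ n)) ^ k = (- v) ^ k * q ^ (k + n * k)" for v k
      using power_mult_distrib[of "- v" "q * q ^ n" k] by (simp add: power_mult power_add power_mult_distrib mult.assoc)
    have "(- w) ^ n * (- (w ^ 2)) ^ n = 1"
      by (simp add: cube_root_of_unity[OF w] power_mult_distrib[symmetric] flip: power3_eq_cube power_Suc)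
    then have sign: "(- w) ^ (n + a) * (- (w ^ 2)) ^ (n + b) = (- w) ^ a * (- (w ^ 2)) ^ b"
      by (simp add: power_add mult_ac)
    \<comment> \<open>By \<open>choose_two_add\<close>, \<open>n + a\<close> and
      \<open>n + b\<close> each contribute \<open>(n choose 2) + n\<close>, and the expansion
      contributes the third \<open>n choose 2\<close>.\<close>
    have expo: "((n + a) choose 2) + ((n + b) choose 2) + (n + a) + (n + b) + (n choose 2)
        = (3 * (n choose 2) + 2 * n) + ((a choose 2) + (a + n * a) + ((b choose 2) + (b + n * b)))"
      by (simp add: choose_two_add)
    have "triple_term (n, a, b) = q ^ (3 * (n choose 2) + 2 * n + ((a choose 2) + (a + n * a) + ((b choose 2) + (b + n * b))))
        * ((- w) ^ a * (- (w ^ 2)) ^ b) * ((- 1) ^ n * qinv q n * qinv q a * qinv q b)"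
      unfolding triple_term_def arg prod.case power_add[of q] by (simp only: mult_ac)
    then show ?thesis
      unfolding expo[symmetric] sign power_add[of q _ "n choose 2"] by (simp only: mult_ac)
  qed
  have "(\<Sum>t | (case t of (n, a, b) \<Rightarrow> (n + a, n + b)) = (i, j). triple_term t)
      = (\<Sum>n\<le>min i j. triple_term (n, i - n, j - n))"
    by (rule sum.reindex_bij_witness[of _ "\<lambda>n. (n, i - n, j - n)" fst]) auto
  also have "\<dots> = (\<Sum>n\<le>min i j. q ^ ((i choose 2) + (j choose 2) + i + j)
      * ((- w) ^ i * (- (w ^ 2)) ^ j)
      * ((- 1) ^ n * q ^ (n choose 2) * qinv q n * qinv q (i - n) * qinv q (j - n)))"
    by (intro sum.cong refl, subst split) simp
  also have "\<dots> = q ^ ((i choose 2) + (j choose 2) + i + j) * ((- w) ^ i * (- (w ^ 2)) ^ j)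
      * (q ^ (i * j) * qinv q i * qinv q j)"
    by (simp only: sum_distrib_left[symmetric] qinv_product_expansion[OF q, symmetric])
  also have "\<dots> = q ^ (((i choose 2) + (j choose 2) + i + j) + i * j)
      * ((- w) ^ i * (- (w ^ 2)) ^ j * qinv q i * qinv q j)"
    unfolding power_add[of q _ "i * j"] by (simp only: mult_ac)
  also have "((i choose 2) + (j choose 2) + i + j) + i * j = Suc (i + j) choose 2"
    by (simp add: choose_two_Suc choose_two_add)
  finally show ?thesis .
qed

section \<open>From the triple sum to the double sum\<close>

text \<open>Isolates the part that depends on \<open>m + 3 * n\<close> alone and so leaves the sum
  over a fibre as a constant factor.\<close>

lemma double_sum_exponent:
  "3 * n * (3 * n + 1) div 2 + m\<^sup>2 + 3 * m * n = (Suc (m + 3 * n) choose 2) + (m choose 2)"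
proof -
  have "Suc (3 * n) choose 2 = 3 * n * (3 * n + 1) div 2"
    by (simp add: choose_two mult.commute)
  moreover have "m\<^sup>2 = 2 * (m choose 2) + m"
    by (induction m) (simp_all add: choose_two_Suc power2_eq_square)
  moreover have "Suc (m + 3 * n) choose 2 = (m choose 2) + (Suc (3 * n) choose 2) + m * Suc (3 * n)"
    using choose_two_add[of m "Suc (3 * n)"] by simp
  ultimately show ?thesis
    by simp
qed

text \<open>The triple sum is grouped by \<open>(i, j)\<close>, then by \<open>N = i + j\<close>;
  for each \<open>N\<close>, \<open>cubic_coefficient_identity\<close> turns the fibre sum into the
  one over \<open>m + 3 * n = N\<close>.\<close>

lemma double_sum_has_sum:
  "((\<lambda>(m, n). q ^ (Suc (m + 3 * n) choose 2) * ((- 1) ^ n * q ^ (m choose 2) * qinv q m * qinv (q ^ 3) n))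
    has_sum (euler_sum (q ^ 3) (q ^ 2) * (euler_sum q (w * q) * euler_sum q (w ^ 2 * q)))) UNIV"
  (is "(?t has_sum ?S) UNIV")
proof -
  have fin: "finite {t. (case t of (n, a, b) \<Rightarrow> (n + a, n + b)) = (i, j)}" for i j :: nat
    by (rule finite_subset[of _ "{..i} \<times> {..i} \<times> {..j}"]) auto
  have fin': "finite {p. (case p of (i, j) \<Rightarrow> i + k * j) = N}" if "k > 0" for k N :: nat
  proof (rule finite_subset[of _ "{..N} \<times> {..N}"])
    show "{p. (case p of (i, j) \<Rightarrow> i + k * j) = N} \<subseteq> {..N} \<times> {..N}"
      using that by (auto intro: trans_le_add2)
  qed simp
  have "((\<lambda>ij. \<Sum>t | (case t of (n, a, b) \<Rightarrow> (n + a, n + b)) = ij. triple_term t) has_sum ?S) UNIV"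
    by (rule has_sum_fibres[OF triple_term_has_sum]) (use fin in auto)
  then have "((\<lambda>(i, j). q ^ (Suc (i + j) choose 2) * ((- w) ^ i * (- (w ^ 2)) ^ j * qinv q i * qinv q j))
      has_sum ?S) UNIV"
    by (rule has_sum_cong[THEN iffD1, rotated]) (auto simp: triple_term_fibre_sum)
  then have "((\<lambda>N. \<Sum>p | (case p of (i, j) \<Rightarrow> i + j) = N.
      (case p of (i, j) \<Rightarrow> q ^ (Suc (i + j) choose 2) * ((- w) ^ i * (- (w ^ 2)) ^ j * qinv q i * qinv q j)))
      has_sum ?S) UNIV"
    by (rule has_sum_fibres) (use fin'[of 1] in simp)
  moreover have "(\<Sum>p | (case p of (i, j) \<Rightarrow> i + j) = N.
      (case p of (i, j) \<Rightarrow> q ^ (Suc (i + j) choose 2) * ((- w) ^ i * (- (w ^ 2)) ^ j * qinv q i * qinv q j)))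
      = (\<Sum>p | (case p of (m, n) \<Rightarrow> m + 3 * n) = N. ?t p)" for N
  proof -
    have "(\<Sum>p | (case p of (i, j) \<Rightarrow> i + j) = N.
        (case p of (i, j) \<Rightarrow> q ^ (Suc (i + j) choose 2) * ((- w) ^ i * (- (w ^ 2)) ^ j * qinv q i * qinv q j)))
        = q ^ (Suc N choose 2) * (\<Sum>(i, j) | i + j = N. (- w) ^ i * (- (w ^ 2)) ^ j * qinv q i * qinv q j)"
      unfolding sum_distrib_left by (rule sum.cong) auto
    also have "\<dots> = q ^ (Suc N choose 2)
        * (\<Sum>(m, n) | m + 3 * n = N. (- 1) ^ n * q ^ (m choose 2) * qinv q m * qinv (q ^ 3) n)"
      by (simp only: cubic_coefficient_identity[OF q w])
    also have "\<dots> = (\<Sum>p | (case p of (m, n) \<Rightarrow> m + 3 * n) = N. ?t p)"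
      unfolding sum_distrib_left by (rule sum.cong) auto
    finally show ?thesis .
  qed
  ultimately have S: "((\<lambda>N. \<Sum>p | (case p of (m, n) \<Rightarrow> m + 3 * n) = N. ?t p) has_sum ?S) UNIV"
    by simp
  \<comment> \<open>Equality of the grouped sums does not by itself give convergence of the double
    sum. It is proved separately, and uniqueness of the grouped sum then identifies its
    value.\<close>
  have "?t summable_on UNIV"
  proof (rule summable_on_if_absv_le[OF majorant_prod_summable])
    fix p :: "nat \<times> nat"
    obtain m n where p: "p = (m, n)"
      by (cases p)
    have "Suc (m + 3 * n) choose 2 \<ge> n choose 2"
      by (rule binomial_right_mono) simp
    then have "absv q ^ (Suc (m + 3 * n) choose 2) * absv (qinv (q ^ 3) n) \<le> majorant n"
      unfolding majorant_def using q
      by (intro mult_mono power_decreasing absv_qinv_cube_le) auto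
    then have "absv (q ^ (m choose 2) * qinv q m)
        * (absv q ^ (Suc (m + 3 * n) choose 2) * absv (qinv (q ^ 3) n)) \<le> majorant m * majorant n"
      by (intro mult_mono absv_power_qinv_le_majorant) (simp_all add: majorant_nonneg)
    then show "absv (?t p) \<le> (case p of (m, n) \<Rightarrow> majorant m * majorant n)"
      by (simp add: p absv_mult absv_power mult_ac)
  qed
  then obtain T where T: "(?t has_sum T) UNIV"
    unfolding summable_on_def by blast
  have "((\<lambda>N. \<Sum>p | (case p of (m, n) \<Rightarrow> m + 3 * n) = N. ?t p) has_sum T) UNIV"
    by (rule has_sum_fibres[OF T]) (use fin'[of 3] in simp)
  then have "T = ?S"
    using S by (rule has_sum_unique)
  then show ?thesis
    using T by simp
qed

text \<open>Letting \<open>n\<close> tend to infinity in \<open>qpoch_cube_product\<close> and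
  \<open>qpoch_trisect\<close> gives two relations between infinite products; combining them leaves
  the common factor \<open>euler_sum (q ^ 3) (q ^ 3)\<close>, which is nonzero and cancels.\<close>

lemma euler_sum_product:
  "euler_sum (q ^ 3) (q ^ 2) * (euler_sum q (w * q) * euler_sum q (w ^ 2 * q)) * euler_sum (q ^ 3) q = 1"
proof -
  note lim = qpoch_tendsto_euler_sum[OF q] qpoch_tendsto_euler_sum[OF absv_q3]
  have "(\<lambda>n. qpoch (q ^ 3) (q ^ 3) n) \<longlonglongrightarrow> euler_sum q q * euler_sum q (w * q) * euler_sum q (w ^ 2 * q)"
    unfolding qpoch_cube_product[OF w, symmetric] by (intro tendsto_mult lim)
  then have 1: "euler_sum q q * euler_sum q (w * q) * euler_sum q (w ^ 2 * q) = euler_sum (q ^ 3) (q ^ 3)"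
    using lim(2) by (rule LIMSEQ_unique)
  have "(\<lambda>n. qpoch q q (3 * n)) \<longlonglongrightarrow> euler_sum (q ^ 3) q * euler_sum (q ^ 3) (q ^ 2) * euler_sum (q ^ 3) (q ^ 3)"
    unfolding qpoch_trisect by (intro tendsto_mult lim)
  moreover have "(\<lambda>n. qpoch q q (3 * n)) \<longlonglongrightarrow> euler_sum q q"
    using LIMSEQ_subseq_LIMSEQ[OF lim(1), of "\<lambda>n. 3 * n"] by (simp add: strict_mono_def o_def)
  ultimately have 2: "euler_sum (q ^ 3) q * euler_sum (q ^ 3) (q ^ 2) * euler_sum (q ^ 3) (q ^ 3) = euler_sum q q"
    by (rule LIMSEQ_unique)
  have "euler_sum (q ^ 3) (q ^ 3) * (euler_sum (q ^ 3) (q ^ 2)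
      * (euler_sum q (w * q) * euler_sum q (w ^ 2 * q)) * euler_sum (q ^ 3) q)
      = euler_sum (q ^ 3) q * euler_sum (q ^ 3) (q ^ 2) * euler_sum (q ^ 3) (q ^ 3)
        * euler_sum q (w * q) * euler_sum q (w ^ 2 * q)"
    by (simp only: mult_ac)
  also have "\<dots> = euler_sum (q ^ 3) (q ^ 3) * 1"
    by (simp only: 1 2 mult_1_right)
  finally show ?thesis
    using euler_sum_nonzero[OF absv_q3 absv_q3] by (simp only: mult_cancel_left) simp
qed

theorem double_sum_identity:
  "((\<lambda>(m, n). (- 1) ^ n * q ^ (3 * n * (3 * n + 1) div 2 + m\<^sup>2 + 3 * m * n)
      div (qpoch q q m * qpoch (q ^ 3) (q ^ 3) n)) has_sum (1 div qpoch_inf q (q ^ 3))) UNIV"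
proof -
  have nz: "euler_sum (q ^ 3) q \<noteq> 0"
    by (rule euler_sum_nonzero[OF absv_q3 q])
  have sum: "1 div qpoch_inf q (q ^ 3)
      = euler_sum (q ^ 3) (q ^ 2) * (euler_sum q (w * q) * euler_sum q (w ^ 2 * q))"
    unfolding qpoch_inf_eq_euler_sum[OF absv_q3 q] euler_sum_product[symmetric]
    by (rule nonzero_mult_div_cancel_right[OF nz])
  have "(- 1) ^ n * q ^ (3 * n * (3 * n + 1) div 2 + m\<^sup>2 + 3 * m * n)
      div (qpoch q q m * qpoch (q ^ 3) (q ^ 3) n)
      = q ^ (Suc (m + 3 * n) choose 2) * ((- 1) ^ n * q ^ (m choose 2) * qinv q m * qinv (q ^ 3) n)"
    (is "?x div ?d = ?y") for m n
  proof -
    \<comment> \<open>The quotient under \<open>div\<close> is determined by clearing the nonzero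
      denominator.\<close>
    have "?y * ?d = ?x * ((qpoch q q m * qinv q m) * (qpoch (q ^ 3) (q ^ 3) n * qinv (q ^ 3) n))"
      unfolding double_sum_exponent power_add by (simp only: mult_ac)
    then have "?y * ?d = ?x"
      by (simp add: qpoch_qinv[OF q] qpoch_qinv[OF absv_q3])
    moreover have "?d \<noteq> 0"
      using qpoch_nonzero[OF q q] qpoch_nonzero[OF absv_q3 absv_q3] by simp
    ultimately show ?thesis
      by (metis nonzero_mult_div_cancel_right)
  qed
  then show ?thesis
    unfolding sum using double_sum_has_sum by simp
qed

end

theorem theorem1p1:
  shows "((\<lambda>(m::nat, n::nat).
            (-1) ^ n * fps_X ^ (3 * n * (3 * n + 1) div 2 + m\<^sup>2 + 3 * m * n)
              / (qpoch fps_X fps_X m * qpoch (fps_X ^ 3) (fps_X ^ 3) n))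
          has_sum (1 / qpoch_inf fps_X (fps_X ^ 3) :: complex fps)) UNIV
      \<and> (\<forall>q::complex. norm q < 1 \<longrightarrow>
        ((\<lambda>(m::nat, n::nat).
            (-1) ^ n * q ^ (3 * n * (3 * n + 1) div 2 + m\<^sup>2 + 3 * m * n)
              / (qpoch q q m * qpoch (q ^ 3) (q ^ 3) n))
          has_sum (1 / qpoch_inf q (q ^ 3))) UNIV)"
proof -
  \<comment> \<open>The primitive cube root of unity \<open>exp (2 * pi * i / 3)\<close>.\<close>
  define w where "w = Complex (- 1 / 2) (sqrt 3 / 2)"
  have w: "1 + w + w ^ 2 = 0"
    by (simp add: w_def complex_eq_iff power2_eq_square)
  \<comment> \<open>Its constant series serves as the cube root of unity among formal power series,
    which is why their coefficients are complex.\<close>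
  have "1 + fps_const w + fps_const w ^ 2 = fps_const (1 + w + w ^ 2)"
    by (simp flip: fps_const_add fps_const_1_eq_1 fps_const_power)
  then have "1 + fps_const w + fps_const w ^ 2 = 0"
    by (simp add: w)
  moreover have "absv (fps_X :: complex fps) < 1"
    by (simp add: absv_fps_X)
  ultimately have "((\<lambda>(m, n). (- 1) ^ n * fps_X ^ (3 * n * (3 * n + 1) div 2 + m\<^sup>2 + 3 * m * n)
      / (qpoch fps_X fps_X m * qpoch (fps_X ^ 3) (fps_X ^ 3) n))
      has_sum (1 / qpoch_inf fps_X (fps_X ^ 3) :: complex fps)) UNIV"
    by (intro double_sum_identity)
  then show ?thesis
    using double_sum_identity[OF _ w] unfolding absv_complex by blast
qed

end
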